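(* Let $G_1$ and $G_2$ be vertex-disjoint finite simple undirected graphs, $v\in V_{G_1}$ and $w\in V_{G_2}$. Then \[\operatorname{nlcw}(G_1\oplus_{v,w}G_2)\le\max(\operatorname{nlcw}(G_1),\operatorname{nlcw}(G_2))+2\quad\text{and}\quad \operatorname{cw}(G_1\oplus_{v,w}G_2)\le\max(\operatorname{cw}(G_1),\operatorname{cw}(G_2))+2.\]
   Context: 1-sum: $G_1\oplus_{v,w}G_2$ is obtained from the disjoint union of $G_1$ and $G_2$ by identifying $v$ and $w$: its vertex set is $(V_{G_1}\cup V_{G_2})\setminus\{v,w\}\cup\{z\}$ for a new vertex $z$, its edges are all edges of $G_1$ and $G_2$ not incident to $v$ or $w$, together with $\{z,z_1\}$ for every $z_1\in N_{G_1}(v)\cup N_{G_2}(w)$. Clique-width: for a positive integer $k$, $\mathrm{CW}_k$ is the smallest class of graphs whose vertices carry labels from $\{1,\dots,k\}$ that contains every single-vertex graph with any label and is closed under: disjoint union; relabeling $\rho_{a\to b}$ for $a\neq b$; and $\eta_{a,b}$ for $a\neq b$ (add all edges between vertices labeled $a$ and vertices labeled $b$). $\operatorname{cw}(G)$ is the least $k$ such that some labeling of $G$ lies in $\mathrm{CW}_k$. NLC-width: $\mathrm{NLC}_k$ is the smallest class of labeled graphs (labels in $\{1,\dots,k\}$) containing every single-vertex graph with any label and closed under: $G\times_S J$ for $S\subseteq\{1,\dots,k\}^2$ (disjoint union of vertex-disjoint $G$ and $J$ plus all edges $\{u,v\}$, $u\in V_G$, $v\in V_J$, $(\mathrm{lab}(u),\mathrm{lab}(v))\in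 S$); and $\circ_R$ for $R:\{1,\dots,k\}\to\{1,\dots,k\}$. $\operatorname{nlcw}(G)$ is the least $k$ such that some labeling of $G$ lies in $\mathrm{NLC}_k$. *)

theory Defs
  imports "Graph_Theory.Pair_Digraph"
begin

text \<open>
  Finite simple undirected graphs are rendered by the locale \<open>pair_graph\<close>: finite, loopless,
  symmetric arc relations, an undirected edge $\{u,v\}$ being the two arcs \<open>(u, v)\<close> and \<open>(v, u)\<close>.
  A labeled graph is a graph together with a function \<open>'a \<Rightarrow> nat\<close>, of which only the values on the
  vertex set matter.
\<close>

definition sym_arcs :: "('a \<times> 'a) set \<Rightarrow> ('a \<times> 'a) set" where
  "sym_arcs A = A \<union> A\<inverse>"

definition neighborhood :: "'a pair_pre_digraph \<Rightarrow> 'a \<Rightarrow> 'a set" where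
  "neighborhood G v = {u. (v, u) \<in> parcs G}"

text \<open>The last argument \<open>z\<close> is the new vertex that replaces the identified pair \<open>v\<close>, \<open>w\<close>.\<close>

definition one_sum ::
  "'a pair_pre_digraph \<Rightarrow> 'a \<Rightarrow> 'a pair_pre_digraph \<Rightarrow> 'a \<Rightarrow> 'a \<Rightarrow> 'a pair_pre_digraph" where
  "one_sum G v H w z =
    \<lparr> pverts = (pverts G \<union> pverts H) - {v, w} \<union> {z},
      parcs = {(x, y) \<in> parcs G \<union> parcs H. x \<notin> {v, w} \<and> y \<notin> {v, w}}
        \<union> sym_arcs ({z} \<times> (neighborhood G v \<union> neighborhood H w)) \<rparr>"

definition union_lab ::
  "'a pair_pre_digraph \<Rightarrow> ('a \<Rightarrow> nat) \<Rightarrow> ('a \<Rightarrow> nat) \<Rightarrow> 'a \<Rightarrow> nat" where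
  "union_lab G lab lab' u = (if u \<in> pverts G then lab u else lab' u)"

inductive CW :: "nat \<Rightarrow> 'a pair_pre_digraph \<Rightarrow> ('a \<Rightarrow> nat) \<Rightarrow> bool" for k :: nat where
  single: "lab v \<in> {1..k} \<Longrightarrow> CW k \<lparr> pverts = {v}, parcs = {} \<rparr> lab"
| disjoint_union: "\<lbrakk> CW k G lab; CW k J lab'; pverts G \<inter> pverts J = {} \<rbrakk> \<Longrightarrow>
    CW k \<lparr> pverts = pverts G \<union> pverts J, parcs = parcs G \<union> parcs J \<rparr> (union_lab G lab lab')"
| relabel: "\<lbrakk> CW k G lab; a \<in> {1..k}; b \<in> {1..k}; a \<noteq> b \<rbrakk> \<Longrightarrow>
    CW k G (\<lambda>u. if lab u = a then b else lab u)"
| add_edges: "\<lbrakk> CW k G lab; a \<in> {1..k}; b \<in> {1..k}; a \<noteq> b \<rbrakk> \<Longrightarrow>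
    CW k \<lparr> pverts = pverts G,
      parcs = parcs G \<union>
        sym_arcs {(u, v). u \<in> pverts G \<and> v \<in> pverts G \<and> lab u = a \<and> lab v = b} \<rparr> lab"

inductive NLC :: "nat \<Rightarrow> 'a pair_pre_digraph \<Rightarrow> ('a \<Rightarrow> nat) \<Rightarrow> bool" for k :: nat where
  single: "lab v \<in> {1..k} \<Longrightarrow> NLC k \<lparr> pverts = {v}, parcs = {} \<rparr> lab"
| join: "\<lbrakk> NLC k G lab; NLC k J lab'; pverts G \<inter> pverts J = {}; S \<subseteq> {1..k} \<times> {1..k} \<rbrakk> \<Longrightarrow>
    NLC k \<lparr> pverts = pverts G \<union> pverts J,
      parcs = parcs G \<union> parcs J \<union>
        sym_arcs {(u, v). u \<in> pverts G \<and> v \<in> pverts J \<and> (lab u, lab' v) \<in> S} \<rparr>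
      (union_lab G lab lab')"
| relabel: "\<lbrakk> NLC k G lab; \<forall>i\<in>{1..k}. R i \<in> {1..k} \<rbrakk> \<Longrightarrow> NLC k G (\<lambda>u. R (lab u))"

definition cw :: "'a pair_pre_digraph \<Rightarrow> nat" where
  "cw G = (LEAST k. k \<ge> 1 \<and> (\<exists>lab. CW k G lab))"

definition nlcw :: "'a pair_pre_digraph \<Rightarrow> nat" where
  "nlcw G = (LEAST k. k \<ge> 1 \<and> (\<exists>lab. NLC k G lab))"

lemma pair_graph_iff:
  "pair_graph G \<longleftrightarrow> finite (pverts G) \<and> parcs G \<subseteq> pverts G \<times> pverts G \<and> sym (parcs G)
    \<and> irrefl (parcs G)"
proof
  assume "pair_graph G"
  then interpret pair_graph G .
  show "finite (pverts G) \<and> parcs G \<subseteq> pverts G \<times> pverts G \<and> sym (parcs G) \<and> irrefl (parcs G)"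
    using pair_finite_verts pair_sym_arcs
    by (auto simp: symmetric_def irrefl_def dest: in_arcsD1 in_arcsD2 pair_no_loops)
next
  assume *: "finite (pverts G) \<and> parcs G \<subseteq> pverts G \<times> pverts G \<and> sym (parcs G) \<and> irrefl (parcs G)"
  moreover from * have "finite (parcs G)"
    using finite_subset by blast
  ultimately show "pair_graph G"
    by unfold_locales (auto simp: symmetric_def irrefl_def)
qed

lemma pair_graph_one_sum:
  assumes "pair_graph G" "pair_graph H" "pverts G \<inter> pverts H = {}"
    "v \<in> pverts G" "w \<in> pverts H" "z \<notin> pverts G \<union> pverts H"
  shows "pair_graph (one_sum G v H w z)"
  using assms unfolding pair_graph_iff one_sum_def neighborhood_def sym_arcs_def sym_def irrefl_def
  by auto

lemma CW_pair_graph: "CW k G lab \<Longrightarrow> pair_graph G \<and> lab ` pverts G \<subseteq> {1..k}"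
  by (induction rule: CW.induct)
    (auto simp: pair_graph_iff sym_arcs_def union_lab_def sym_def irrefl_def)

lemma NLC_pair_graph: "NLC k G lab \<Longrightarrow> pair_graph G \<and> lab ` pverts G \<subseteq> {1..k}"
  by (induction rule: NLC.induct)
    (auto simp: pair_graph_iff sym_arcs_def union_lab_def sym_def irrefl_def)

end

theory Submission
  imports Defs
begin

text \<open>
  Fix expressions of width at most $k$ for both graphs. In an expression of a graph $H$ the leaf
  creating a vertex $w$ may be replaced by any graph $F$ with a distinguished vertex $z$, at the
  cost of two further labels: $z$ takes over the role of $w$ under the private label $k + 1$, and
  the other vertices of $F$ carry the dead label $k + 2$, which is never addressed again.
  Replacing $v$ in $G_1$ by the single vertex $z$, then relabelling all vertices other than $z$ to
  $k + 2$, and finally replacing $w$ in $G_2$ by the resulting graph yields the 1-sum.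
\<close>

section \<open>Labelings that matter only on the vertex set\<close>

text \<open>
  The inductive predicates also constrain the values of the labeling off the vertex set (after a
  relabeling $a \to b$ the value $a$ is not taken anywhere); the following variants do not.
\<close>

definition CWV :: "nat \<Rightarrow> 'a pair_pre_digraph \<Rightarrow> ('a \<Rightarrow> nat) \<Rightarrow> bool" where
  "CWV k G l \<longleftrightarrow> (\<exists>lab. CW k G lab \<and> (\<forall>u\<in>pverts G. lab u = l u))"

definition NLCV :: "nat \<Rightarrow> 'a pair_pre_digraph \<Rightarrow> ('a \<Rightarrow> nat) \<Rightarrow> bool" where
  "NLCV k G l \<longleftrightarrow> (\<exists>lab. NLC k G lab \<and> (\<forall>u\<in>pverts G. lab u = l u))"

lemma CWV_cong: "\<lbrakk> CWV k G l; \<And>u. u \<in> pverts G \<Longrightarrow> l' u = l u \<rbrakk> \<Longrightarrow> CWV k G l'"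
  unfolding CWV_def by fastforce

lemma NLCV_cong: "\<lbrakk> NLCV k G l; \<And>u. u \<in> pverts G \<Longrightarrow> l' u = l u \<rbrakk> \<Longrightarrow> NLCV k G l'"
  unfolding NLCV_def by fastforce

lemma CWV_single: "l v \<in> {1..k} \<Longrightarrow> CWV k \<lparr> pverts = {v}, parcs = {} \<rparr> l"
  unfolding CWV_def using CW.single[of l v k] by auto

lemma NLCV_single: "l v \<in> {1..k} \<Longrightarrow> NLCV k \<lparr> pverts = {v}, parcs = {} \<rparr> l"
  unfolding NLCV_def using NLC.single[of l v k] by auto

lemma CWV_disjoint_union:
  assumes "CWV k G l" "CWV k J l" "pverts G \<inter> pverts J = {}"
  shows "CWV k \<lparr> pverts = pverts G \<union> pverts J, parcs = parcs G \<union> parcs J \<rparr> l"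
proof -
  obtain f g where "CW k G f" "CW k J g"
    and "\<forall>u\<in>pverts G. f u = l u" "\<forall>u\<in>pverts J. g u = l u"
    using assms unfolding CWV_def by auto
  then show ?thesis
    using CW.disjoint_union[of k G f J g] assms(3) unfolding CWV_def
    by (intro exI[of _ "union_lab G f g"]) (auto simp: union_lab_def)
qed

lemma CWV_relabel:
  assumes "CWV k G l" "a \<in> {1..k}" "b \<in> {1..k}" "a \<noteq> b"
  shows "CWV k G (\<lambda>u. if l u = a then b else l u)"
proof -
  obtain f where "CW k G f" "\<forall>u\<in>pverts G. f u = l u"
    using assms unfolding CWV_def by auto
  then show ?thesis
    using CW.relabel[of k G f a b] assms unfolding CWV_def
    by (intro exI[of _ "\<lambda>u. if f u = a then b else f u"]) auto
qed

lemma CWV_add_edges: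
  assumes "CWV k G l" "a \<in> {1..k}" "b \<in> {1..k}" "a \<noteq> b"
  shows "CWV k \<lparr> pverts = pverts G, parcs = parcs G \<union>
    sym_arcs {(u, v). u \<in> pverts G \<and> v \<in> pverts G \<and> l u = a \<and> l v = b} \<rparr> l"
proof -
  obtain f where f: "CW k G f" "\<forall>u\<in>pverts G. f u = l u"
    using assms unfolding CWV_def by auto
  then have "{(u, v). u \<in> pverts G \<and> v \<in> pverts G \<and> f u = a \<and> f v = b} =
    {(u, v). u \<in> pverts G \<and> v \<in> pverts G \<and> l u = a \<and> l v = b}"
    by auto
  then show ?thesis
    using CW.add_edges[of k G f a b] assms f unfolding CWV_def
    by (intro exI[of _ f]) auto
qed

lemma NLCV_join:
  assumes "NLCV k G l" "NLCV k J l" "pverts G \<inter> pverts J = {}" "S \<subseteq> {1..k} \<times> {1..k}"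
  shows "NLCV k \<lparr> pverts = pverts G \<union> pverts J, parcs = parcs G \<union> parcs J \<union>
    sym_arcs {(u, v). u \<in> pverts G \<and> v \<in> pverts J \<and> (l u, l v) \<in> S} \<rparr> l"
proof -
  obtain f g where fg: "NLC k G f" "NLC k J g"
    "\<forall>u\<in>pverts G. f u = l u" "\<forall>u\<in>pverts J. g u = l u"
    using assms unfolding NLCV_def by auto
  then have "{(u, v). u \<in> pverts G \<and> v \<in> pverts J \<and> (f u, g v) \<in> S} =
    {(u, v). u \<in> pverts G \<and> v \<in> pverts J \<and> (l u, l v) \<in> S}"
    by auto
  then show ?thesis
    using NLC.join[OF fg(1,2) assms(3,4)] fg(3,4) assms(3) unfolding NLCV_def
    by (intro exI[of _ "union_lab G f g"]) (auto simp: union_lab_def)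
qed

lemma NLCV_relabel:
  assumes "NLCV k G l" "\<forall>i\<in>{1..k}. R i \<in> {1..k}"
  shows "NLCV k G (\<lambda>u. R (l u))"
proof -
  obtain f where "NLC k G f" "\<forall>u\<in>pverts G. f u = l u"
    using assms unfolding NLCV_def by auto
  then show ?thesis
    using NLC.relabel[of k G f R] assms unfolding NLCV_def
    by (intro exI[of _ "\<lambda>u. R (f u)"]) auto
qed

section \<open>Monotonicity in the number of labels\<close>

lemma CW_imp_CWV: "CW k G lab \<Longrightarrow> CWV k G lab"
  unfolding CWV_def by auto

lemma CW_mono: "CW k G lab \<Longrightarrow> k \<le> k' \<Longrightarrow> CW k' G lab"
proof (induction rule: CW.induct)
  case (single lab v)
  then show ?case
    by (intro CW.single) auto
next
  case (disjoint_union G lab J lab')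
  then show ?case
    by (intro CW.disjoint_union) auto
next
  case (relabel G lab a b)
  then show ?case
    by (intro CW.relabel) auto
next
  case (add_edges G lab a b)
  then show ?case
    by (intro CW.add_edges) auto
qed

text \<open>Unlike for clique-width, the very same labeling need not survive the step from
  \<open>k\<close> to \<open>k'\<close>: a map \<open>R\<close> admissible for \<open>k\<close> may
  send labels between \<open>k + 1\<close> and \<open>k'\<close> out of range. Replacing
  \<open>R\<close> by the identity above \<open>k\<close> repairs this and changes the labeling only
  off the vertex set, whence the conclusion with \<open>NLCV\<close>.\<close>

lemma NLC_imp_NLCV: "NLC k G lab \<Longrightarrow> k \<le> k' \<Longrightarrow> NLCV k' G lab"
proof (induction rule: NLC.induct)
  case (single lab v)
  then show ?case
    by (auto intro!: NLCV_single)
next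
  case (join G lab J lab' S)
  let ?l = "union_lab G lab lab'"
  have "NLCV k' G ?l"
    by (rule NLCV_cong[of _ _ lab]) (use join in \<open>auto simp: union_lab_def\<close>)
  moreover have "NLCV k' J ?l"
    by (rule NLCV_cong[of _ _ lab']) (use join in \<open>auto simp: union_lab_def\<close>)
  moreover have "S \<subseteq> {1..k'} \<times> {1..k'}"
    using join by fastforce
  ultimately have "NLCV k' \<lparr> pverts = pverts G \<union> pverts J, parcs = parcs G \<union> parcs J \<union>
    sym_arcs {(u, v). u \<in> pverts G \<and> v \<in> pverts J \<and> (?l u, ?l v) \<in> S} \<rparr> ?l"
    using join by (intro NLCV_join) auto
  moreover have "{(u, v). u \<in> pverts G \<and> v \<in> pverts J \<and> (?l u, ?l v) \<in> S} =
    {(u, v). u \<in> pverts G \<and> v \<in> pverts J \<and> (lab u, lab' v) \<in> S}"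
    using join.hyps by (auto simp: union_lab_def)
  ultimately show ?case
    by simp
next
  case (relabel G lab R)
  let ?R = "\<lambda>i. if i \<in> {1..k} then R i else i"
  have "NLCV k' G (\<lambda>u. ?R (lab u))"
    using relabel by (intro NLCV_relabel[where R = ?R]) fastforce+
  then show ?case
    using NLC_pair_graph[OF relabel.hyps(1)] by (elim NLCV_cong) auto
qed

text \<open>A clique-width relabeling renames one label at a time, so a whole set of labels is
  merged into \<open>b\<close> by induction. Since \<open>b\<close> lies outside \<open>A\<close>,
  each single step has two distinct labels.\<close>

lemma CWV_relabel_set:
  assumes "CWV n F l" "A \<subseteq> {1..n}" "b \<in> {1..n}" "b \<notin> A"
  shows "CWV n F (\<lambda>u. if l u \<in> A then b else l u)"
proof -
  have "finite A"
    using assms(2) finite_subset by blast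
  then show ?thesis
    using assms(2,4)
  proof (induction A rule: finite_induct)
    case empty
    then show ?case
      using assms(1) by simp
  next
    case (insert a A)
    let ?l = "\<lambda>u. if l u \<in> A then b else l u"
    have "CWV n F (\<lambda>u. if ?l u = a then b else ?l u)"
      using insert assms(3) by (intro CWV_relabel) auto
    then show ?case
      by (rule CWV_cong) (use insert in auto)
  qed
qed

section \<open>Every finite graph has an expression\<close>

lemma CWV_no_edges:
  assumes "finite V" "V \<noteq> {}" "l ` V \<subseteq> {1..n}"
  shows "CWV n \<lparr> pverts = V, parcs = {} \<rparr> l"
  using assms
proof (induction V rule: finite_ne_induct)
  case (singleton x)
  then show ?case
    by (intro CWV_single) auto
next
  case (insert x V)
  then show ?case
    using CWV_disjoint_union[of n "\<lparr> pverts = {x}, parcs = {} \<rparr>" l "\<lparr> pverts = V, parcs = {} \<rparr>"]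
      CWV_single[of l x n] by auto
qed

text \<open>When all vertices carry different labels, one edge insertion creates exactly one edge.
  The graph is built from its edgeless version, edge by edge.\<close>

lemma CWV_inj_labeling:
  assumes "finite V" "V \<noteq> {}" "l ` V \<subseteq> {1..n}" "inj_on l V"
    and "finite E" "E \<subseteq> V \<times> V" "irrefl E"
  shows "CWV n \<lparr> pverts = V, parcs = sym_arcs E \<rparr> l"
  using assms(5-7)
proof (induction E rule: finite_induct)
  case empty
  then show ?case
    using CWV_no_edges[OF assms(1-3)] by (simp add: sym_arcs_def)
next
  case (insert e E)
  obtain x y where e: "e = (x, y)"
    by fastforce
  with insert.prems have xy: "x \<in> V" "y \<in> V" "x \<noteq> y"
    by (auto simp: irrefl_def)
  then have "l x \<noteq> l y" "l x \<in> {1..n}" "l y \<in> {1..n}"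
    using assms(3,4) by (auto dest: inj_onD)
  moreover have "CWV n \<lparr> pverts = V, parcs = sym_arcs E \<rparr> l"
    using insert by (auto simp: irrefl_def)
  moreover have "{(u, v). u \<in> V \<and> v \<in> V \<and> l u = l x \<and> l v = l y} = {(x, y)}"
    using xy assms(4) by (auto dest: inj_onD)
  moreover have "sym_arcs (insert e E) = sym_arcs E \<union> sym_arcs {(x, y)}"
    by (auto simp: e sym_arcs_def)
  ultimately show ?case
    using CWV_add_edges[of n "\<lparr> pverts = V, parcs = sym_arcs E \<rparr>" l "l x" "l y"] by simp
qed

text \<open>NLC-expressions create edges only while joining, so the induction runs over the
  vertices: the new vertex is joined to those already present, and by injectivity the label relation
  can single out precisely its neighbours. Keeping \<open>E\<close> fixed and restricting it to
  \<open>V\<close> makes the induction go through.\<close>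

lemma NLCV_inj_labeling:
  assumes "finite V" "V \<noteq> {}" "l ` V \<subseteq> {1..n}" "inj_on l V" "sym E" "irrefl E"
  shows "NLCV n \<lparr> pverts = V, parcs = E \<inter> V \<times> V \<rparr> l"
  using assms
proof (induction V rule: finite_ne_induct)
  case (singleton x)
  then have "E \<inter> {x} \<times> {x} = {}"
    by (auto simp: irrefl_def)
  then show ?case
    using singleton NLCV_single[of l x n] by simp
next
  case (insert x V)
  let ?S = "{(l u, l x) | u. u \<in> V \<and> (u, x) \<in> E}"
  have "NLCV n \<lparr> pverts = V, parcs = E \<inter> V \<times> V \<rparr> l"
    using insert by auto
  moreover have "NLCV n \<lparr> pverts = {x}, parcs = {} \<rparr> l"
    using insert by (intro NLCV_single) auto
  moreover have "?S \<subseteq> {1..n} \<times> {1..n}"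
    using insert.prems by auto
  moreover have "{(u, v). u \<in> V \<and> v \<in> {x} \<and> (l u, l v) \<in> ?S} = {(u, x) | u. u \<in> V \<and> (u, x) \<in> E}"
    using insert.prems by (auto dest: inj_onD)
  moreover have "E \<inter> insert x V \<times> insert x V =
      E \<inter> V \<times> V \<union> sym_arcs {(u, x) | u. u \<in> V \<and> (u, x) \<in> E}"
    using insert.prems by (auto simp: sym_arcs_def irrefl_def dest: symD)
  ultimately show ?case
    using insert.hyps
      NLCV_join[of n "\<lparr> pverts = V, parcs = E \<inter> V \<times> V \<rparr>" l "\<lparr> pverts = {x}, parcs = {} \<rparr>" ?S]
    by simp
qed

section \<open>The minimal width is attained\<close>

lemma obtains_inj_labeling:
  assumes "finite V"
  obtains l :: "'a \<Rightarrow> nat" where "inj_on l V" "l ` V \<subseteq> {1..card V}"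
proof -
  have "card V = card {1..card V}"
    by simp
  then obtain l where "bij_betw l V {1..card V}"
    using finite_same_card_bij[OF assms, of "{1..card V}"] by auto
  then show ?thesis
    using that by (auto simp: bij_betw_def)
qed

text \<open>\<open>LEAST\<close> says something only once some width is known to be possible; the
  number of vertices is one, by an injective labeling.\<close>

lemma CW_cw:
  assumes "pair_graph G" "pverts G \<noteq> {}"
  obtains lab where "CW (cw G) G lab"
proof -
  have G: "finite (pverts G)" "parcs G \<subseteq> pverts G \<times> pverts G" "sym (parcs G)" "irrefl (parcs G)"
    using assms(1) by (auto simp: pair_graph_iff)
  obtain l :: "'a \<Rightarrow> nat" where l: "inj_on l (pverts G)" "l ` pverts G \<subseteq> {1..card (pverts G)}"
    using obtains_inj_labeling[OF G(1)] by blast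
  have "finite (parcs G)"
    using G(1,2) finite_subset by blast
  \<comment> \<open>The arc set is already symmetric, so closing it under converse changes
    nothing.\<close>
  moreover have "\<lparr> pverts = pverts G, parcs = sym_arcs (parcs G) \<rparr> = G"
    using G(3) by (auto simp: sym_arcs_def dest: symD intro!: pair_pre_digraph.equality)
  ultimately have "CWV (card (pverts G)) G l"
    using CWV_inj_labeling[OF G(1) assms(2) l(2,1) _ G(2,4)] by simp
  moreover have "card (pverts G) \<ge> 1"
    using G(1) assms(2) by (simp add: Suc_le_eq card_gt_0_iff)
  ultimately have "\<exists>k. k \<ge> 1 \<and> (\<exists>lab. CW k G lab)"
    unfolding CWV_def by blast
  from LeastI_ex[OF this] show ?thesis
    using that unfolding cw_def by blast
qed

lemma NLC_nlcw:
  assumes "pair_graph G" "pverts G \<noteq> {}"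
  obtains lab where "NLC (nlcw G) G lab"
proof -
  have G: "finite (pverts G)" "parcs G \<subseteq> pverts G \<times> pverts G" "sym (parcs G)" "irrefl (parcs G)"
    using assms(1) by (auto simp: pair_graph_iff)
  obtain l :: "'a \<Rightarrow> nat" where l: "inj_on l (pverts G)" "l ` pverts G \<subseteq> {1..card (pverts G)}"
    using obtains_inj_labeling[OF G(1)] by blast
  have "\<lparr> pverts = pverts G, parcs = parcs G \<inter> pverts G \<times> pverts G \<rparr> = G"
    using G(2) by (auto intro!: pair_pre_digraph.equality)
  then have "NLCV (card (pverts G)) G l"
    using NLCV_inj_labeling[OF G(1) assms(2) l(2,1) G(3,4)] by simp
  moreover have "card (pverts G) \<ge> 1"
    using G(1) assms(2) by (simp add: Suc_le_eq card_gt_0_iff)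
  ultimately have "\<exists>k. k \<ge> 1 \<and> (\<exists>lab. NLC k G lab)"
    unfolding NLCV_def by blast
  from LeastI_ex[OF this] show ?thesis
    using that unfolding nlcw_def by blast
qed

lemma cw_le: "CWV k G l \<Longrightarrow> k \<ge> 1 \<Longrightarrow> cw G \<le> k"
  unfolding cw_def CWV_def by (rule Least_le) blast

lemma nlcw_le: "NLCV k G l \<Longrightarrow> k \<ge> 1 \<Longrightarrow> nlcw G \<le> k"
  unfolding nlcw_def NLCV_def by (rule Least_le) blast

section \<open>Replacing a vertex by a graph\<close>

text \<open>This is not a modular substitution: only \<open>z\<close> inherits the neighbours of
  \<open>w\<close>, the other vertices of \<open>F\<close> get no arcs to \<open>H\<close>. The
  intended use has \<open>F\<close> disjoint from \<open>H\<close> and \<open>z\<close> in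
  \<open>F\<close>. For a one-vertex \<open>F\<close> it renames \<open>w\<close> to
  \<open>z\<close>.\<close>

definition attach ::
  "'a pair_pre_digraph \<Rightarrow> 'a \<Rightarrow> 'a pair_pre_digraph \<Rightarrow> 'a \<Rightarrow> 'a pair_pre_digraph" where
  "attach H w F z =
    \<lparr> pverts = (pverts H - {w}) \<union> pverts F,
      parcs = {(x, y) \<in> parcs H. x \<noteq> w \<and> y \<noteq> w} \<union> parcs F
        \<union> sym_arcs ({z} \<times> neighborhood H w) \<rparr>"

text \<open>With \<open>z\<close> in \<open>F\<close>, the values on \<open>F\<close> do not depend
  on \<open>lab\<close>, so one labeled copy of \<open>F\<close> fits every stage of an expression
  for \<open>H\<close>.\<close>

definition attach_lab ::
  "nat \<Rightarrow> 'a pair_pre_digraph \<Rightarrow> 'a \<Rightarrow> ('a \<Rightarrow> nat) \<Rightarrow> 'a \<Rightarrow> nat" where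
  "attach_lab k F z lab u = (if u = z then k + 1 else if u \<in> pverts F then k + 2 else lab u)"

lemma attach_single:
  "attach \<lparr> pverts = {w}, parcs = {} \<rparr> w F z = F"
  by (simp add: attach_def neighborhood_def sym_arcs_def)

lemma attach_union_left:
  fixes G J :: "'a pair_pre_digraph"
  assumes "w \<notin> pverts J" "parcs J \<subseteq> pverts J \<times> pverts J"
  shows "attach \<lparr> pverts = pverts G \<union> pverts J, parcs = parcs G \<union> parcs J \<rparr> w F z =
    \<lparr> pverts = pverts (attach G w F z) \<union> pverts J,
      parcs = parcs (attach G w F z) \<union> parcs J \<rparr>"
proof -
  have "neighborhood J w = {}" "{(x, y) \<in> parcs J. x \<noteq> w \<and> y \<noteq> w} = parcs J"
    "pverts J - {w} = pverts J"
    using assms by (auto simp: neighborhood_def)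
  moreover have "neighborhood \<lparr> pverts = pverts G \<union> pverts J, parcs = parcs G \<union> parcs J \<rparr> w =
      neighborhood G w \<union> neighborhood J w"
    by (auto simp: neighborhood_def)
  moreover have "{(x, y) \<in> parcs G \<union> parcs J. x \<noteq> w \<and> y \<noteq> w} =
      {(x, y) \<in> parcs G. x \<noteq> w \<and> y \<noteq> w} \<union> {(x, y) \<in> parcs J. x \<noteq> w \<and> y \<noteq> w}"
    by auto
  ultimately show ?thesis
    by (simp add: attach_def Un_Diff Un_ac)
qed

lemma attach_union_right:
  fixes G J :: "'a pair_pre_digraph"
  assumes "w \<notin> pverts G" "parcs G \<subseteq> pverts G \<times> pverts G"
  shows "attach \<lparr> pverts = pverts G \<union> pverts J, parcs = parcs G \<union> parcs J \<rparr> w F z =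
    \<lparr> pverts = pverts G \<union> pverts (attach J w F z),
      parcs = parcs G \<union> parcs (attach J w F z) \<rparr>"
  using attach_union_left[OF assms, of J F z] by (simp add: Un_commute)

text \<open>Separates the edges created by a join from the underlying disjoint union, to which
  \<open>attach_union_left\<close> and \<open>attach_union_right\<close> apply.\<close>

lemma attach_add_arcs:
  "attach \<lparr> pverts = V, parcs = A \<union> E \<rparr> w F z =
    \<lparr> pverts = pverts (attach \<lparr> pverts = V, parcs = A \<rparr> w F z),
      parcs = parcs (attach \<lparr> pverts = V, parcs = A \<rparr> w F z) \<union>
        ({(x, y) \<in> E. x \<noteq> w \<and> y \<noteq> w} \<union> sym_arcs ({z} \<times> {u. (w, u) \<in> E})) \<rparr>"
  by (auto simp: attach_def neighborhood_def sym_arcs_def)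

text \<open>Induction along the expression of \<open>H\<close>. The leaf \<open>w\<close> becomes
  \<open>F\<close>; afterwards \<open>lab w\<close> still records which label \<open>w\<close> would
  have, while \<open>z\<close> stays at \<open>k + 1\<close>. Only edge insertion has to consult
  that record.\<close>

lemma CWV_attach:
  assumes "CW k H lab" "w \<in> pverts H" "pverts H \<inter> pverts F = {}" "z \<in> pverts F"
    and F: "CWV (k + 2) F (attach_lab k F z f)"
  shows "CWV (k + 2) (attach H w F z) (attach_lab k F z lab)"
  using assms(1-3)
proof (induction rule: CW.induct)
  case (single lab v)
  have "CWV (k + 2) F (attach_lab k F z lab)"
    by (rule CWV_cong[OF F]) (simp add: attach_lab_def)
  with single show ?case
    by (simp add: attach_single)
next
  case (disjoint_union G lab J lab')
  note GJ = CW_pair_graph[OF disjoint_union.hyps(1)] CW_pair_graph[OF disjoint_union.hyps(2)]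
  let ?l = "attach_lab k F z (union_lab G lab lab')"
  show ?case
  proof (cases "w \<in> pverts G")
    case True
    with disjoint_union have w: "w \<notin> pverts J"
      by auto
    have "CWV (k + 2) (attach G w F z) (attach_lab k F z lab)"
      using True disjoint_union by auto
    then have "CWV (k + 2) (attach G w F z) ?l"
      by (rule CWV_cong) (auto simp: attach_def attach_lab_def union_lab_def)
    moreover have "CWV (k + 2) J ?l"
      using disjoint_union.hyps disjoint_union.prems assms(4)
      by (intro CWV_cong[OF CW_imp_CWV[OF CW_mono[OF disjoint_union.hyps(2)]]])
        (auto simp: attach_lab_def union_lab_def)
    moreover have "pverts (attach G w F z) \<inter> pverts J = {}"
      using disjoint_union.hyps disjoint_union.prems by (auto simp: attach_def)
    ultimately show ?thesis
      using w GJ CWV_disjoint_union by (subst attach_union_left) (auto simp: pair_graph_iff)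
  next
    case False
    have "CWV (k + 2) (attach J w F z) (attach_lab k F z lab')"
      using False disjoint_union by auto
    then have "CWV (k + 2) (attach J w F z) ?l"
      by (rule CWV_cong)
        (use disjoint_union in \<open>auto simp: attach_def attach_lab_def union_lab_def\<close>)
    moreover have "CWV (k + 2) G ?l"
      using disjoint_union.hyps disjoint_union.prems assms(4)
      by (intro CWV_cong[OF CW_imp_CWV[OF CW_mono[OF disjoint_union.hyps(1)]]])
        (auto simp: attach_lab_def union_lab_def)
    moreover have "pverts G \<inter> pverts (attach J w F z) = {}"
      using disjoint_union.hyps disjoint_union.prems by (auto simp: attach_def)
    ultimately show ?thesis
      using False GJ CWV_disjoint_union by (subst attach_union_right) (auto simp: pair_graph_iff)
  qed
next
  case (relabel G lab a b)
  \<comment> \<open>Both \<open>a\<close> and \<open>b\<close> are at most \<open>k\<close>, so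
    \<open>z\<close> and the dead vertices keep their labels.\<close>
  then have "CWV (k + 2) (attach G w F z)
      (\<lambda>u. if attach_lab k F z lab u = a then b else attach_lab k F z lab u)"
    by (intro CWV_relabel) auto
  then show ?case
    by (rule CWV_cong) (use relabel in \<open>auto simp: attach_lab_def\<close>)
next
  case (add_edges G lab a b)
  let ?l = "attach_lab k F z lab"
  let ?A = "attach G w F z"
  let ?add = "\<lambda>X a b. \<lparr> pverts = pverts X, parcs = parcs X \<union>
    sym_arcs {(u, v). u \<in> pverts X \<and> v \<in> pverts X \<and> ?l u = a \<and> ?l v = b} \<rparr>"
  text \<open>The vertex \<open>z\<close> has lost the label of \<open>w\<close>, so its new edges are added separately.\<close>
  define B where "B = ?add ?A a b"
  define C where "C = (if lab w = a then ?add B (k + 1) b else B)"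
  define D where "D = (if lab w = b then ?add C a (k + 1) else C)"
  have "CWV (k + 2) ?A ?l"
    using add_edges by auto
  then have "CWV (k + 2) B ?l"
    unfolding B_def using add_edges by (intro CWV_add_edges) auto
  then have "CWV (k + 2) C ?l"
    unfolding C_def using add_edges by (auto intro: CWV_add_edges)
  then have "CWV (k + 2) D ?l"
    unfolding D_def using add_edges by (auto intro: CWV_add_edges)
  moreover have "D = attach \<lparr> pverts = pverts G, parcs = parcs G \<union>
      sym_arcs {(u, v). u \<in> pverts G \<and> v \<in> pverts G \<and> lab u = a \<and> lab v = b} \<rparr> w F z"
  proof -
    have lab_le: "lab u \<le> k" if "u \<in> pverts G" for u
      using CW_pair_graph[OF add_edges.hyps(1)] that by auto
    \<comment> \<open>Labels up to \<open>k\<close> occur only on the surviving vertices of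
      \<open>H\<close>, as all of \<open>F\<close> is labeled \<open>k + 1\<close> or
      \<open>k + 2\<close>.\<close>
    have old: "u \<in> pverts ?A \<and> ?l u = c \<longleftrightarrow> u \<in> pverts G \<and> u \<noteq> w \<and> lab u = c"
      if "c \<in> {1..k}" for u c
      using that add_edges.prems assms(4) by (auto simp: attach_def attach_lab_def)
    have new: "u \<in> pverts ?A \<and> ?l u = k + 1 \<longleftrightarrow> u = z" for u
      using assms(4) by (auto simp: attach_def attach_lab_def dest: lab_le)
    \<comment> \<open>\<open>B\<close>, \<open>C\<close> and \<open>D\<close> share the vertex set
      of \<open>?A\<close>, hence also its label classes; each insertion is a product of two such
      classes.\<close>
    have add: "?add X c d = \<lparr> pverts = pverts ?A, parcs = parcs X \<union>
        sym_arcs ({u \<in> pverts ?A. ?l u = c} \<times> {u \<in> pverts ?A. ?l u = d}) \<rparr>"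
      if "pverts X = pverts ?A" for X c d
      using that by (auto simp: sym_arcs_def)
    let ?P = "\<lambda>c. {u. u \<in> pverts G \<and> u \<noteq> w \<and> lab u = c}"
    have P: "{u \<in> pverts ?A. ?l u = a} = ?P a" "{u \<in> pverts ?A. ?l u = b} = ?P b"
      "{u \<in> pverts ?A. ?l u = k + 1} = {z}"
      using add_edges.hyps by (simp_all only: old new) auto
    have "B = \<lparr> pverts = pverts ?A, parcs = parcs ?A \<union> sym_arcs (?P a \<times> ?P b) \<rparr>"
      unfolding B_def by (subst add) (simp_all only: P)
    moreover from this have "C = \<lparr> pverts = pverts ?A, parcs = parcs B \<union>
        (if lab w = a then sym_arcs ({z} \<times> ?P b) else {}) \<rparr>"
      unfolding C_def by (subst add) (simp_all only: P, simp_all)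
    moreover from this have "D = \<lparr> pverts = pverts ?A, parcs = parcs C \<union>
        (if lab w = b then sym_arcs (?P a \<times> {z}) else {}) \<rparr>"
      unfolding D_def by (subst add) (simp_all only: P, simp_all)
    ultimately have "D = \<lparr> pverts = pverts ?A, parcs = parcs ?A \<union> sym_arcs (?P a \<times> ?P b) \<union>
        (if lab w = a then sym_arcs ({z} \<times> ?P b) else {}) \<union>
        (if lab w = b then sym_arcs (?P a \<times> {z}) else {}) \<rparr>"
      by simp
    \<comment> \<open>As \<open>a\<close> and \<open>b\<close> differ, \<open>w\<close> is never
      joined to itself, so its new neighbours form exactly the class that was joined to
      \<open>z\<close>.\<close>
    then show ?thesis
      using add_edges.hyps(4) add_edges.prems(1)
      by (auto simp: attach_def neighborhood_def sym_arcs_def)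
  qed
  ultimately show ?case
    by simp
qed

text \<open>The same induction as for clique-width, but edges now arise in joins: a single join with
  an enlarged label relation serves \<open>z\<close> along with the other vertices.\<close>

lemma NLCV_attach:
  assumes "NLC k H lab" "w \<in> pverts H" "pverts H \<inter> pverts F = {}" "z \<in> pverts F"
    and F: "NLCV (k + 2) F (attach_lab k F z f)"
  shows "NLCV (k + 2) (attach H w F z) (attach_lab k F z lab)"
  using assms(1-3)
proof (induction rule: NLC.induct)
  case (single lab v)
  have "NLCV (k + 2) F (attach_lab k F z lab)"
    by (rule NLCV_cong[OF F]) (simp add: attach_lab_def)
  with single show ?case
    by (simp add: attach_single)
next
  case (join G lab J lab' S)
  note GJ = NLC_pair_graph[OF join.hyps(1)] NLC_pair_graph[OF join.hyps(2)]
  let ?l = "attach_lab k F z (union_lab G lab lab')"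
  show ?case
  proof (cases "w \<in> pverts G")
    case True
    let ?A = "attach G w F z"
    \<comment> \<open>Label \<open>k + 1\<close> copies the pairs of the label of \<open>w\<close>;
      label \<open>k + 2\<close> appears in no pair, so the rest of \<open>F\<close> receives no
      edges.\<close>
    define T where "T = S \<union> {(k + 1, j) | j. (lab w, j) \<in> S}"
    from True join have w: "w \<notin> pverts J"
      by auto
    have "NLCV (k + 2) ?A (attach_lab k F z lab)"
      using True join by auto
    then have "NLCV (k + 2) ?A ?l"
      by (rule NLCV_cong) (auto simp: attach_def attach_lab_def union_lab_def)
    moreover have "NLCV (k + 2) J ?l"
      using join.hyps join.prems assms(4)
      by (intro NLCV_cong[OF NLC_imp_NLCV[OF join.hyps(2)]]) (auto simp: attach_lab_def union_lab_def)
    moreover have "pverts ?A \<inter> pverts J = {}"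
      using join.hyps join.prems by (auto simp: attach_def)
    moreover have "T \<subseteq> {1..k + 2} \<times> {1..k + 2}"
      using join.hyps by (fastforce simp: T_def)
    ultimately have "NLCV (k + 2) \<lparr> pverts = pverts ?A \<union> pverts J, parcs = parcs ?A \<union> parcs J \<union>
        sym_arcs {(u, v). u \<in> pverts ?A \<and> v \<in> pverts J \<and> (?l u, ?l v) \<in> T} \<rparr> ?l"
      by (rule NLCV_join)
    moreover have "{(u, v). u \<in> pverts ?A \<and> v \<in> pverts J \<and> (?l u, ?l v) \<in> T} =
        {(u, v). u \<in> pverts G \<and> u \<noteq> w \<and> v \<in> pverts J \<and> (lab u, lab' v) \<in> S} \<union>
        {z} \<times> {v \<in> pverts J. (lab w, lab' v) \<in> S}"
    proof -
      have "?l v = lab' v" if "v \<in> pverts J" for v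
        using that join.hyps join.prems assms(4) by (auto simp: attach_lab_def union_lab_def)
      moreover have "?l u = lab u" "lab u \<noteq> k + 1" "u \<noteq> z" if "u \<in> pverts G" for u
        using that join.prems assms(4) GJ by (auto simp: attach_lab_def union_lab_def)
      moreover have "?l z = k + 1" "?l u = (if u = z then k + 1 else k + 2)" if "u \<in> pverts F" for u
        using that by (auto simp: attach_lab_def)
      moreover have "(k + 1, j) \<notin> S" "(k + 2, j) \<notin> S" for j
        using join.hyps by auto
      ultimately show ?thesis
        using assms(4) by (auto simp: attach_def T_def split: if_splits)
    qed
    moreover have "attach \<lparr> pverts = pverts G \<union> pverts J, parcs = parcs G \<union> parcs J \<union>
        sym_arcs {(u, v). u \<in> pverts G \<and> v \<in> pverts J \<and> (lab u, lab' v) \<in> S} \<rparr> w F z =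
      \<lparr> pverts = pverts ?A \<union> pverts J, parcs = parcs ?A \<union> parcs J \<union>
        sym_arcs ({(u, v). u \<in> pverts G \<and> u \<noteq> w \<and> v \<in> pverts J \<and> (lab u, lab' v) \<in> S} \<union>
          {z} \<times> {v \<in> pverts J. (lab w, lab' v) \<in> S}) \<rparr>"
    proof -
      let ?E = "{(u, v). u \<in> pverts G \<and> v \<in> pverts J \<and> (lab u, lab' v) \<in> S}"
      have "{(x, y) \<in> sym_arcs ?E. x \<noteq> w \<and> y \<noteq> w} \<union> sym_arcs ({z} \<times> {u. (w, u) \<in> sym_arcs ?E}) =
        sym_arcs ({(u, v). u \<in> pverts G \<and> u \<noteq> w \<and> v \<in> pverts J \<and> (lab u, lab' v) \<in> S} \<union>
          {z} \<times> {v \<in> pverts J. (lab w, lab' v) \<in> S})"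
        using True w by (auto simp: sym_arcs_def)
      then show ?thesis
        using True w GJ
        by (simp add: attach_add_arcs[where A = "parcs G \<union> parcs J"] attach_union_left pair_graph_iff)
    qed
    ultimately show ?thesis
      by simp
  next
    case False
    let ?A = "attach J w F z"
    \<comment> \<open>Now \<open>w\<close> lies in the second operand, so the private label is added
      in the second component.\<close>
    define T where "T = S \<union> {(i, k + 1) | i. (i, lab' w) \<in> S}"
    from False join have w: "w \<in> pverts J"
      by auto
    have "NLCV (k + 2) ?A (attach_lab k F z lab')"
      using False join by auto
    then have "NLCV (k + 2) ?A ?l"
      by (rule NLCV_cong) (use join in \<open>auto simp: attach_def attach_lab_def union_lab_def\<close>)
    moreover have "NLCV (k + 2) G ?l"
      using join.hyps join.prems assms(4)
      by (intro NLCV_cong[OF NLC_imp_NLCV[OF join.hyps(1)]]) (auto simp: attach_lab_def union_lab_def)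
    moreover have "pverts G \<inter> pverts ?A = {}"
      using join.hyps join.prems by (auto simp: attach_def)
    moreover have "T \<subseteq> {1..k + 2} \<times> {1..k + 2}"
      using join.hyps by (fastforce simp: T_def)
    ultimately have "NLCV (k + 2) \<lparr> pverts = pverts G \<union> pverts ?A, parcs = parcs G \<union> parcs ?A \<union>
        sym_arcs {(u, v). u \<in> pverts G \<and> v \<in> pverts ?A \<and> (?l u, ?l v) \<in> T} \<rparr> ?l"
      by (intro NLCV_join)
    moreover have "{(u, v). u \<in> pverts G \<and> v \<in> pverts ?A \<and> (?l u, ?l v) \<in> T} =
        {(u, v). u \<in> pverts G \<and> v \<in> pverts J \<and> v \<noteq> w \<and> (lab u, lab' v) \<in> S} \<union>
        {u \<in> pverts G. (lab u, lab' w) \<in> S} \<times> {z}"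
    proof -
      have "?l v = lab' v" "lab' v \<noteq> k + 1" "v \<noteq> z" if "v \<in> pverts J" for v
        using that join.hyps join.prems assms(4) GJ by (auto simp: attach_lab_def union_lab_def)
      moreover have "?l u = lab u" if "u \<in> pverts G" for u
        using that join.prems assms(4) by (auto simp: attach_lab_def union_lab_def)
      moreover have "?l z = k + 1" "?l u = (if u = z then k + 1 else k + 2)" if "u \<in> pverts F" for u
        using that by (auto simp: attach_lab_def)
      moreover have "(j, k + 1) \<notin> S" "(j, k + 2) \<notin> S" for j
        using join.hyps by auto
      ultimately show ?thesis
        using assms(4) by (auto simp: attach_def T_def split: if_splits)
    qed
    moreover have "attach \<lparr> pverts = pverts G \<union> pverts J, parcs = parcs G \<union> parcs J \<union>
        sym_arcs {(u, v). u \<in> pverts G \<and> v \<in> pverts J \<and> (lab u, lab' v) \<in> S} \<rparr> w F z =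
      \<lparr> pverts = pverts G \<union> pverts ?A, parcs = parcs G \<union> parcs ?A \<union>
        sym_arcs ({(u, v). u \<in> pverts G \<and> v \<in> pverts J \<and> v \<noteq> w \<and> (lab u, lab' v) \<in> S} \<union>
          {u \<in> pverts G. (lab u, lab' w) \<in> S} \<times> {z}) \<rparr>"
    proof -
      let ?E = "{(u, v). u \<in> pverts G \<and> v \<in> pverts J \<and> (lab u, lab' v) \<in> S}"
      have "{(x, y) \<in> sym_arcs ?E. x \<noteq> w \<and> y \<noteq> w} \<union> sym_arcs ({z} \<times> {u. (w, u) \<in> sym_arcs ?E}) =
        sym_arcs ({(u, v). u \<in> pverts G \<and> v \<in> pverts J \<and> v \<noteq> w \<and> (lab u, lab' v) \<in> S} \<union>
          {u \<in> pverts G. (lab u, lab' w) \<in> S} \<times> {z})"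
        using False w by (auto simp: sym_arcs_def)
      then show ?thesis
        using False w GJ
        by (simp add: attach_add_arcs[where A = "parcs G \<union> parcs J"] attach_union_right pair_graph_iff)
    qed
    ultimately show ?thesis
      by simp
  qed
next
  case (relabel G lab R)
  \<comment> \<open>The identity above \<open>k\<close> protects the two extra labels.\<close>
  let ?R = "\<lambda>i. if i \<in> {1..k} then R i else i"
  have "NLCV (k + 2) (attach G w F z) (\<lambda>u. ?R (attach_lab k F z lab u))"
  proof (rule NLCV_relabel[where R = ?R])
    show "NLCV (k + 2) (attach G w F z) (attach_lab k F z lab)"
      using relabel by auto
    show "\<forall>i\<in>{1..k + 2}. ?R i \<in> {1..k + 2}"
      using relabel.hyps by fastforce
  qed
  then show ?case
    by (rule NLCV_cong)
      (use NLC_pair_graph[OF relabel.hyps(1)] in \<open>auto simp: attach_lab_def attach_def\<close>)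
qed

text \<open>The inner replacement renames \<open>v\<close> to \<open>z\<close> in \<open>G1\<close>;
  the outer one puts the result in place of \<open>w\<close>, so that \<open>z\<close> also gains
  the neighbours of \<open>w\<close>. By disjointness, arcs of \<open>G1\<close> avoid
  \<open>w\<close> and arcs of \<open>G2\<close> avoid \<open>v\<close>, hence the joint deletion of
  both vertices splits into two separate ones.\<close>

lemma one_sum_eq_attach:
  assumes "pair_graph G1" and "pair_graph G2"
    and "pverts G1 \<inter> pverts G2 = {}"
    and "v \<in> pverts G1" and "w \<in> pverts G2"
  shows "one_sum G1 v G2 w z = attach G2 w (attach G1 v \<lparr> pverts = {z}, parcs = {} \<rparr> z) z"
proof -
  have "x \<noteq> w \<and> y \<noteq> w" if "(x, y) \<in> parcs G1" for x y
    using that assms by (auto simp: pair_graph_iff)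
  moreover have "x \<noteq> v \<and> y \<noteq> v" if "(x, y) \<in> parcs G2" for x y
    using that assms by (auto simp: pair_graph_iff)
  ultimately have "{(x, y) \<in> parcs G1 \<union> parcs G2. x \<notin> {v, w} \<and> y \<notin> {v, w}} =
      {(x, y) \<in> parcs G1. x \<noteq> v \<and> y \<noteq> v} \<union> {(x, y) \<in> parcs G2. x \<noteq> w \<and> y \<noteq> w}"
    by blast
  moreover have "pverts G1 \<union> pverts G2 - {v, w} \<union> {z} =
      pverts G2 - {w} \<union> (pverts G1 - {v} \<union> {z})"
    using assms by blast
  moreover have "sym_arcs ({z} \<times> (A \<union> B)) = sym_arcs ({z} \<times> A) \<union> sym_arcs ({z} \<times> B)" for A B
    by (auto simp: sym_arcs_def)
  ultimately show ?thesis
    by (simp add: one_sum_def attach_def Un_ac)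
qed

section \<open>Width bounds for the 1-sum\<close>

lemma CWV_one_sum:
  assumes G: "CW k G1 f" "CW k G2 g"
    and disj: "pverts G1 \<inter> pverts G2 = {}"
    and vw: "v \<in> pverts G1" "w \<in> pverts G2"
    and z: "z \<notin> pverts G1 \<union> pverts G2"
  shows "\<exists>l. CWV (k + 2) (one_sum G1 v G2 w z) l"
proof -
  let ?Z = "\<lparr> pverts = {z}, parcs = {} \<rparr>"
  let ?F = "attach G1 v ?Z z"
  let ?l = "attach_lab k ?Z z f"
  have "CWV (k + 2) ?F ?l"
    using z vw by (intro CWV_attach[OF G(1), of _ _ _ f] CWV_single) (auto simp: attach_lab_def)
  \<comment> \<open>All vertices of \<open>?F\<close> except \<open>z\<close> become dead, which is
    the labeling required for inserting \<open>?F\<close> into \<open>G2\<close>. The labels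
    \<open>1\<close> to \<open>k\<close> are thereby free for the expression of
    \<open>G2\<close>.\<close>
  then have "CWV (k + 2) ?F (\<lambda>u. if ?l u \<in> {1..k} then k + 2 else ?l u)"
    by (rule CWV_relabel_set) auto
  then have "CWV (k + 2) ?F (attach_lab k ?F z g)"
    by (rule CWV_cong)
      (use CW_pair_graph[OF G(1)] in \<open>auto simp: attach_lab_def attach_def\<close>)
  then have "CWV (k + 2) (attach G2 w ?F z) (attach_lab k ?F z g)"
    using z vw disj by (intro CWV_attach[OF G(2), of _ _ _ g]) (auto simp: attach_def)
  moreover have "pair_graph G1" "pair_graph G2"
    using G by (auto dest: CW_pair_graph)
  ultimately show ?thesis
    using one_sum_eq_attach[OF _ _ disj vw] by auto
qed

lemma NLCV_one_sum:
  assumes G: "NLC k G1 f" "NLC k G2 g"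
    and disj: "pverts G1 \<inter> pverts G2 = {}"
    and vw: "v \<in> pverts G1" "w \<in> pverts G2"
    and z: "z \<notin> pverts G1 \<union> pverts G2"
  shows "\<exists>l. NLCV (k + 2) (one_sum G1 v G2 w z) l"
proof -
  let ?Z = "\<lparr> pverts = {z}, parcs = {} \<rparr>"
  let ?F = "attach G1 v ?Z z"
  let ?l = "attach_lab k ?Z z f"
  have "NLCV (k + 2) ?F ?l"
    using z vw by (intro NLCV_attach[OF G(1), of _ _ _ f] NLCV_single) (auto simp: attach_lab_def)
  \<comment> \<open>In the NLC setting one relabeling map kills all these labels at once.\<close>
  then have "NLCV (k + 2) ?F (\<lambda>u. if ?l u \<in> {1..k} then k + 2 else ?l u)"
    by (rule NLCV_relabel[where R = "\<lambda>i. if i \<in> {1..k} then k + 2 else i"]) auto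
  then have "NLCV (k + 2) ?F (attach_lab k ?F z g)"
    by (rule NLCV_cong)
      (use NLC_pair_graph[OF G(1)] in \<open>auto simp: attach_lab_def attach_def\<close>)
  then have "NLCV (k + 2) (attach G2 w ?F z) (attach_lab k ?F z g)"
    using z vw disj by (intro NLCV_attach[OF G(2), of _ _ _ g]) (auto simp: attach_def)
  moreover have "pair_graph G1" "pair_graph G2"
    using G by (auto dest: NLC_pair_graph)
  ultimately show ?thesis
    using one_sum_eq_attach[OF _ _ disj vw] by auto
qed

theorem theorem4:
  fixes G1 G2 :: "'a pair_pre_digraph" and v w z :: 'a
  assumes "pair_graph G1" and "pair_graph G2"
    and "pverts G1 \<inter> pverts G2 = {}"
    and "v \<in> pverts G1" and "w \<in> pverts G2"
    and "z \<notin> pverts G1 \<union> pverts G2"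
  shows "nlcw (one_sum G1 v G2 w z) \<le> max (nlcw G1) (nlcw G2) + 2
    \<and> cw (one_sum G1 v G2 w z) \<le> max (cw G1) (cw G2) + 2"
proof
  have ne: "pverts G1 \<noteq> {}" "pverts G2 \<noteq> {}"
    using assms(4,5) by auto
  show "nlcw (one_sum G1 v G2 w z) \<le> max (nlcw G1) (nlcw G2) + 2"
  proof -
    let ?k = "max (nlcw G1) (nlcw G2)"
    obtain f g where "NLC (nlcw G1) G1 f" "NLC (nlcw G2) G2 g"
      using NLC_nlcw[OF assms(1) ne(1)] NLC_nlcw[OF assms(2) ne(2)] by metis
    then have "NLCV ?k G1 f" "NLCV ?k G2 g"
      by (auto intro: NLC_imp_NLCV)
    \<comment> \<open>Raising the width may have altered the labelings off the vertex sets, so fresh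
      ones are chosen.\<close>
    then obtain f' g' where "NLC ?k G1 f'" "NLC ?k G2 g'"
      unfolding NLCV_def by auto
    from NLCV_one_sum[OF this assms(3-6)] show ?thesis
      by (auto intro: nlcw_le)
  qed
  show "cw (one_sum G1 v G2 w z) \<le> max (cw G1) (cw G2) + 2"
  proof -
    let ?k = "max (cw G1) (cw G2)"
    obtain f g where "CW (cw G1) G1 f" "CW (cw G2) G2 g"
      using CW_cw[OF assms(1) ne(1)] CW_cw[OF assms(2) ne(2)] by metis
    then have "CW ?k G1 f" "CW ?k G2 g"
      by (auto intro: CW_mono)
    from CWV_one_sum[OF this assms(3-6)] show ?thesis
      by (auto intro: cw_le)
  qed
qed

end
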